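(* Let $N\ge 1$, let $\nu_0,\nu_N$ be probability distributions on $\mathcal X=\{1,\dots,n\}$, and let $\mathfrak M$ be the prior measure determined by $\mu_0$ and the matrices $M(t)=[m_{ij}(t)]_{i,j=1}^n$, $t=0,\dots,N-1$ (see context). Assume that the matrix $$G:=M(0)M(1)\cdots M(N-2)M(N-1)=(g_{ij})$$ has all positive elements $g_{ij}$. Suppose there exist two functions $\varphi$ and $\hat\varphi$ mapping $\{0,1,\dots,N\}\times\mathcal X$ into the nonnegative reals and satisfying the generalized Schrödinger system $$\varphi(t,i)=\sum_{j}m_{ij}(t)\,\varphi(t+1,j),\qquad 0\le t\le N-1,$$ $$\hat\varphi(t+1,j)=\sum_{i}m_{ij}(t)\,\hat\varphi(t,i),\qquad 0\le t\le N-1,$$ $$\varphi(0,i)\,\hat\varphi(0,i)=\nu_0(i),$$ $$\varphi(N,j)^2\,\hat\varphi(N,j)=\nu_N(j),$$ for all $i,j\in\mathcal X$. For $0\le t\le N-1$ and $(i,j)\in\mathcal X\times\mathcal X$, define $$\pi^*_{ij}(t):=m_{ij}(t)\,\frac{\varphi(t+1,j)}{\varphi(t,i)},$$ which constitute a family of bona fide transition probabilities (i.e. $\pi^*_{ij}(t)\ge 0$ and $\sum_j\pi^*_{ij}(t)=1$). Then the solution to the problem $$\text{minimize } J(P):=\mathbb D(P\|\mathfrak M)+\mathbb D(p_N\|\nu_N)\quad\text{over } P\in\mathcal P(\nu_0)$$ is unique and given by the Markovian distribution $$\mathfrak P^*(x_0,\dots,x_N)=\nu_0(x_0)\,\pi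^*_{x_0x_1}(0)\cdots\pi^*_{x_{N-1}x_N}(N-1).$$
   Context: Setting. $\mathbf G=(\mathcal X,\mathcal E)$ is a directed, strongly connected, aperiodic graph with vertex set $\mathcal X=\{1,\dots,n\}$ and edge set $\mathcal E\subseteq\mathcal X\times\mathcal X$. For each $t\in\{0,\dots,N-1\}$, $M(t)=[m_{ij}(t)]_{i,j=1}^n$ is a matrix with $m_{ij}(t)\ge 0$, and $m_{ij}(t)=0$ whenever $(i,j)\notin\mathcal E$; the rows of $M(t)$ need not sum to one. $\mu_0$ is a nonnegative measure on $\mathcal X$ with $\mu_0(x)>0$ for all $x\in\mathcal X$. The prior measure on paths $(x_0,\dots,x_N)\in\mathcal X^{N+1}$ (not necessarily of total mass one) is $$\mathfrak M(x_0,x_1,\dots,x_N)=\mu_0(x_0)\,m_{x_0x_1}(0)\cdots m_{x_{N-1}x_N}(N-1).$$ Relative entropy. For nonnegative measures $P,Q$ on a finite set, $\mathbb D(P\|Q)=\sum_x P(x)\log\frac{P(x)}{Q(x)}$ if $\mathrm{Supp}(P)\subseteq\mathrm{Supp}(Q)$, and $\mathbb D(P\|Q)=+\infty$ otherwise, with the convention $0\cdot\log 0=0$. Feasible set. $\mathcal P(\nu_0)$ is the family of all Markovian probability distributions on $\mathcal X^{N+1}$ with initial marginal $\nu_0$, i.e. of the form $P(x_0,\dots,x_N)=\nu_0(x_0)\pi_{x_0x_1}(0)\cdots\pi_{x_{N-1}x_N}(N-1)$ with transition probabilities $\pi_{ij}(t)$. For $P\in\mathcal P(\nu_0)$, $p_N$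 denotes the marginal of $P$ at time $N$.
   Formalization: The claim that π*(t) is a family of transition probabilities is asserted only for rows with φ(t,i)>0, since the quotient is undefined where φ(t,i)=0; it is added that φ(0,i)>0 and that states with positive probability under P* have φ(t,i)>0. *)

theory Defs
  imports "HOL-Analysis.Analysis"
begin

definition strongly_connected :: "('v \<times> 'v) set \<Rightarrow> bool" where
  "strongly_connected E \<longleftrightarrow> (\<forall>i j. (i, j) \<in> E\<^sup>*)"

(* Closed walks have the same gcd of lengths as simple cycles. A graph without
   closed walks is not aperiodic, because Gcd {} = 0. *)
definition aperiodic :: "('v \<times> 'v) set \<Rightarrow> bool" where
  "aperiodic E \<longleftrightarrow> Gcd {k::nat. 0 < k \<and> (\<exists>i. (i, i) \<in> E ^^ k)} = 1"

definition prob_vector :: "('v::finite \<Rightarrow> real) \<Rightarrow> bool" where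
  "prob_vector p \<longleftrightarrow> (\<forall>i. 0 \<le> p i) \<and> (\<Sum>i\<in>UNIV. p i) = 1"

primrec mat_prod :: "(nat \<Rightarrow> real^'v^'v) \<Rightarrow> nat \<Rightarrow> real^'v::finite^'v" where
  "mat_prod M 0 = mat 1"
| "mat_prod M (Suc k) = mat_prod M k ** M k"

text \<open>A path \<open>(x\<^sub>0, \<dots>, x\<^sub>N)\<close> is a list of length \<open>N + 1\<close>.\<close>

definition paths :: "nat \<Rightarrow> 'v list set" where
  "paths N = {x. length x = Suc N}"

text \<open>Measures on path space are given by their mass functions, extended by zero to lists
  of other lengths, so that equality of functions is equality of measures on path space.
  The matrices need not be stochastic: the prior measure has this form too.\<close>

definition path_measure ::
    "nat \<Rightarrow> ('v \<Rightarrow> real) \<Rightarrow> (nat \<Rightarrow> real^'v::finite^'v) \<Rightarrow> 'v list \<Rightarrow> real" where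
  "path_measure N \<mu> M x =
     (if x \<in> paths N then \<mu> (x ! 0) * (\<Prod>t<N. M t $ (x ! t) $ (x ! Suc t)) else 0)"

definition transition_probs :: "nat \<Rightarrow> (nat \<Rightarrow> real^'v::finite^'v) \<Rightarrow> bool" where
  "transition_probs N \<pi> \<longleftrightarrow> (\<forall>t<N. \<forall>i. prob_vector (\<lambda>j. \<pi> t $ i $ j))"

definition markov_family :: "nat \<Rightarrow> ('v::finite \<Rightarrow> real) \<Rightarrow> ('v list \<Rightarrow> real) set" where
  "markov_family N \<nu> = {path_measure N \<nu> \<pi> | \<pi>. transition_probs N \<pi>}"

definition marginal :: "nat \<Rightarrow> ('v list \<Rightarrow> real) \<Rightarrow> nat \<Rightarrow> 'v \<Rightarrow> real" where
  "marginal N P t i = (\<Sum>x | x \<in> paths N \<and> x ! t = i. P x)"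

text \<open>For nonnegative \<open>P\<close>, \<open>Q\<close> on a finite set \<open>A\<close>. The convention \<open>0 log 0 = 0\<close> needs no
  case distinction, since \<open>ln\<close> is total and its value is multiplied by zero.\<close>

definition rel_entropy :: "'a set \<Rightarrow> ('a \<Rightarrow> real) \<Rightarrow> ('a \<Rightarrow> real) \<Rightarrow> ereal" where
  "rel_entropy A P Q =
     (if {x \<in> A. P x \<noteq> 0} \<subseteq> {x \<in> A. Q x \<noteq> 0}
      then ereal (\<Sum>x\<in>A. P x * ln (P x / Q x)) else \<infinity>)"

definition cost ::
    "nat \<Rightarrow> ('v::finite list \<Rightarrow> real) \<Rightarrow> ('v \<Rightarrow> real) \<Rightarrow> ('v list \<Rightarrow> real) \<Rightarrow> ereal" where
  "cost N \<MM> \<nu>\<^sub>N P = rel_entropy (paths N) P \<MM> + rel_entropy UNIV (marginal N P N) \<nu>\<^sub>N"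

(* Entries with \<phi> t i = 0 are 0 here (division by zero); there the quotient is undefined
   in the usual sense. *)
definition opt_transition ::
    "(nat \<Rightarrow> real^'v^'v) \<Rightarrow> (nat \<Rightarrow> 'v \<Rightarrow> real) \<Rightarrow> nat \<Rightarrow> real^'v::finite^'v" where
  "opt_transition M \<phi> t = (\<chi> i j. M t $ i $ j * (\<phi> (Suc t) j / \<phi> t i))"

end

theory Submission imports Defs begin

text \<open>
  The system forces the objective to split into two divergences from the candidate and a constant.
  Cancelling \<open>\<phi> t\<close> along a path turns the candidate into
    \<^item> \<open>P\<^sup>*(x) = \<phi>' 0 x\<^sub>0 * m * \<dots> * m * \<phi> N x\<^sub>N\<close>,
  so its density with respect to the prior is \<open>\<phi>' 0 x\<^sub>0 / \<mu>\<^sub>0 x\<^sub>0 * \<phi> N x\<^sub>N\<close>, a function of the two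
  endpoints only, and its final marginal is \<open>p\<^sup>* = \<phi>' N * \<phi> N\<close>.  Hence for every \<open>P\<close> of
  finite cost with initial marginal \<open>\<nu>\<^sub>0\<close> and final marginal \<open>p\<close>,
    \<^item> \<open>D(P | prior) = D(P | P\<^sup>*) + \<Sum>i. \<nu>\<^sub>0 i * ln (\<phi>' 0 i / \<mu>\<^sub>0 i) + \<Sum>j. p j * ln (\<phi> N j)\<close>,
    \<^item> \<open>D(p | \<nu>\<^sub>N) = D(p | p\<^sup>*) - \<Sum>j. p j * ln (\<phi> N j)\<close>,
  the latter because the square in the terminal condition \<open>(\<phi> N)\<^sup>2 * \<phi>' N = \<nu>\<^sub>N\<close> leaves one factor
  \<open>\<phi> N\<close> between \<open>\<nu>\<^sub>N\<close> and \<open>p\<^sup>*\<close>.  In the sum the terms that depend on \<open>p\<close> cancel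
  (\<open>cost_decomposition\<close>).  By Gibbs' inequality both divergences are nonnegative and vanish at
  \<open>P\<^sup>*\<close>, and the first vanishes nowhere else, which gives optimality and uniqueness together.

  Zeros need care.  Positivity of \<open>M 0 ** \<dots> ** M (N - 1)\<close> gives \<open>\<phi> 0 > 0\<close> and \<open>\<phi>' N > 0\<close>, but
  \<open>\<phi> t\<close> may vanish at intermediate times (a row of \<open>M t\<close> can be zero) and \<open>\<phi> N\<close> vanishes
  exactly where \<open>\<nu>\<^sub>N\<close> does.  In the first case the candidate's matrices have zero rows; these are
  attached to states of probability zero and can be replaced by arbitrary stochastic rows
  (\<open>optimum_in_markov_family\<close>).  In the second case \<open>P\<^sup>*\<close> misses paths that the prior may charge, but
  a \<open>P\<close> that charges them has infinite terminal cost, so the decomposition also holds between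
  infinite values.
\<close>

section \<open>Sums over paths\<close>

lemma finite_paths: "finite (paths N :: 'v::finite list set)"
  using finite_lists_length_eq[of "UNIV :: 'v set" "Suc N"] by (simp add: paths_def)

lemma sum_paths_Suc:
  "(\<Sum>x\<in>paths (Suc N). f x) = (\<Sum>x\<in>paths N. \<Sum>a\<in>(UNIV :: 'v::finite set). f (x @ [a]))"
proof -
  have "bij_betw (\<lambda>(x, a). x @ [a]) (paths N \<times> UNIV) (paths (Suc N) :: 'v list set)"
    by (rule bij_betwI[where g = "\<lambda>x. (butlast x, last x)"])
      (auto simp: paths_def intro!: append_butlast_last_id)
  then have "(\<Sum>x\<in>paths (Suc N). f x) = (\<Sum>(x, a)\<in>paths N \<times> UNIV. f (x @ [a]))"
    by (simp add: sum.reindex_bij_betw[symmetric] case_prod_unfold)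
  then show ?thesis
    by (simp add: sum.cartesian_product)
qed

lemma path_measure_append:
  assumes "x \<in> paths N"
  shows "path_measure (Suc N) \<mu> M (x @ [a]) = path_measure N \<mu> M x * M N $ (x ! N) $ a"
  using assms by (auto simp: path_measure_def paths_def nth_append intro!: prod.cong)

lemma marginal_conv_sum: "marginal N P t i = (\<Sum>x\<in>paths N. P x * of_bool (x ! t = i))"
  for P :: "'v::finite list \<Rightarrow> real"
  unfolding marginal_def by (intro sum.mono_neutral_cong_left) (auto simp: finite_paths)

text \<open>Functions of a single coordinate are integrated against the marginal.  This is how the
  logarithm of an endpoint density becomes a sum over states.\<close>

lemma sum_paths_marginal:
  fixes P :: "'v::finite list \<Rightarrow> real"
  shows "(\<Sum>x\<in>paths N. P x * h (x ! t)) = (\<Sum>i\<in>UNIV. marginal N P t i * h i)"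
proof -
  have "(\<Sum>i\<in>UNIV. marginal N P t i * h i)
      = (\<Sum>i\<in>UNIV. \<Sum>x\<in>{x \<in> paths N. x ! t = i}. P x * h (x ! t))"
    by (simp add: marginal_def sum_distrib_right)
  also have "\<dots> = (\<Sum>x\<in>paths N. P x * h (x ! t))"
    by (rule sum.group) (auto simp: finite_paths)
  finally show ?thesis by simp
qed

lemma sum_paths_eq_sum_marginal:
  fixes P :: "'v::finite list \<Rightarrow> real"
  shows "(\<Sum>x\<in>paths N. P x) = (\<Sum>i\<in>UNIV. marginal N P t i)"
  using sum_paths_marginal[of P "\<lambda>_. 1" t N] by simp

lemma path_measure_nonneg:
  assumes "\<And>i. 0 \<le> \<mu> i" and "\<And>t i j. t < N \<Longrightarrow> 0 \<le> M t $ i $ j"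
  shows "0 \<le> path_measure N \<mu> M x"
  using assms by (auto simp: path_measure_def intro!: mult_nonneg_nonneg prod_nonneg)

lemma marginal_nonneg:
  assumes "\<And>x. 0 \<le> P x"
  shows "0 \<le> marginal N P t i"
  using assms by (simp add: marginal_def sum_nonneg)

lemma marginal_eq_0_iff:
  fixes P :: "'v::finite list \<Rightarrow> real"
  assumes "\<And>x. 0 \<le> P x"
  shows "marginal N P t i = 0 \<longleftrightarrow> (\<forall>x\<in>paths N. x ! t = i \<longrightarrow> P x = 0)"
  using assms by (auto simp: marginal_def sum_nonneg_eq_0_iff finite_paths)

text \<open>Appending a step multiplies the mass of a prefix by a row sum, so stochastic rows keep the
  law of the starting point.\<close>

lemma marginal_path_measure_initial:
  assumes "\<And>t i. t < N \<Longrightarrow> (\<Sum>j\<in>UNIV. \<pi> t $ i $ j) = 1"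
  shows "marginal N (path_measure N \<nu> \<pi>) 0 i = \<nu> i"
  using assms
proof (induction N)
  case 0
  have "(\<Sum>x\<in>paths 0. path_measure 0 \<nu> \<pi> x * of_bool (x ! 0 = i))
      = (\<Sum>a\<in>UNIV. \<nu> a * of_bool (a = i))"
    by (rule sum.reindex_bij_witness[where i = "\<lambda>a. [a]" and j = hd])
      (auto simp: paths_def path_measure_def length_Suc_conv)
  also have "\<dots> = \<nu> i"
    by (simp add: of_bool_def if_distrib cong: if_cong)
  finally show ?case
    by (simp add: marginal_conv_sum)
next
  case (Suc N)
  have "marginal (Suc N) (path_measure (Suc N) \<nu> \<pi>) 0 i
      = (\<Sum>x\<in>paths N. \<Sum>a\<in>UNIV. path_measure N \<nu> \<pi> x * of_bool (x ! 0 = i) * \<pi> N $ (x ! N) $ a)"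
    unfolding marginal_conv_sum sum_paths_Suc
    by (intro sum.cong refl) (auto simp: path_measure_append, auto simp: paths_def nth_append)
  also have "\<dots> = marginal N (path_measure N \<nu> \<pi>) 0 i"
    unfolding marginal_conv_sum sum_distrib_left[symmetric] by (simp add: Suc.prems)
  also have "\<dots> = \<nu> i"
    using Suc by simp
  finally show ?case .
qed

text \<open>The forward recursion propagates the law of the current state of a path measure.\<close>

lemma marginal_path_measure_final:
  assumes "\<And>t j. t < N \<Longrightarrow> f (Suc t) j = (\<Sum>i\<in>UNIV. M t $ i $ j * f t i)"
  shows "marginal N (path_measure N (f 0) M) N j = f N j"
  using assms
proof (induction N arbitrary: j)
  case 0
  then show ?case by (simp add: marginal_path_measure_initial)
next
  case (Suc N)
  have "marginal (Suc N) (path_measure (Suc N) (f 0) M) (Suc N) j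
      = (\<Sum>x\<in>paths N. \<Sum>a\<in>UNIV. path_measure N (f 0) M x * M N $ (x ! N) $ a * of_bool (a = j))"
    unfolding marginal_conv_sum sum_paths_Suc
    by (intro sum.cong refl) (auto simp: path_measure_append, auto simp: paths_def nth_append)
  also have "\<dots> = (\<Sum>x\<in>paths N. path_measure N (f 0) M x * M N $ (x ! N) $ j)"
    by (simp add: of_bool_def if_distrib cong: if_cong)
  also have "\<dots> = (\<Sum>i\<in>UNIV. f N i * M N $ i $ j)"
    using Suc by (simp add: sum_paths_marginal[where h = "\<lambda>i. M N $ i $ j"])
  also have "\<dots> = f (Suc N) j"
    by (simp add: Suc.prems mult.commute)
  finally show ?case .
qed

section \<open>Relative entropy\<close>

text \<open>This is \<open>ln y \<le> y - 1\<close> at \<open>y = q / p\<close>, with its case of equality.  Between measures of the same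
  mass the terms \<open>p - q\<close> add up to zero, which yields Gibbs' inequality below.\<close>

lemma Gibbs_pointwise:
  fixes p q :: real
  assumes "0 \<le> p" and "0 \<le> q" and "p \<noteq> 0 \<Longrightarrow> q \<noteq> 0"
  shows "p - q \<le> p * ln (p / q)" and "p * ln (p / q) = p - q \<longleftrightarrow> p = q"
proof -
  have "p - q \<le> p * ln (p / q) \<and> (p * ln (p / q) = p - q \<longleftrightarrow> p = q)"
  proof (cases "p = 0")
    case True
    then show ?thesis using assms by auto
  next
    case False
    then have pos: "0 < p" "0 < q" using assms by auto
    have eq: "p * ln (p / q) - (p - q) = p * (q / p - 1 - ln (q / p))"
      using pos by (simp add: ln_div field_simps)
    have "ln (q / p) \<le> q / p - 1" using pos by (intro ln_le_minus_one) simp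
    then have "0 \<le> p * ln (p / q) - (p - q)" using pos by (simp add: eq)
    moreover have "p = q" if "p * ln (p / q) = p - q"
    proof -
      have "ln (q / p) = q / p - 1" using that eq pos by simp
      then have "q / p = 1" using pos by (intro ln_eq_minus_one) auto
      then show ?thesis using pos by simp
    qed
    ultimately show ?thesis using pos by auto
  qed
  then show "p - q \<le> p * ln (p / q)" and "p * ln (p / q) = p - q \<longleftrightarrow> p = q" by auto
qed

lemma
  fixes P Q :: "'a \<Rightarrow> real"
  assumes "finite A" and "\<And>x. x \<in> A \<Longrightarrow> 0 \<le> P x" and "\<And>x. x \<in> A \<Longrightarrow> 0 \<le> Q x"
    and mass: "sum P A = sum Q A"
  shows rel_entropy_nonneg: "0 \<le> rel_entropy A P Q"
    and rel_entropy_eq_0_iff: "rel_entropy A P Q = 0 \<longleftrightarrow> (\<forall>x\<in>A. P x = Q x)"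
proof -
  have "0 \<le> rel_entropy A P Q \<and> (rel_entropy A P Q = 0 \<longleftrightarrow> (\<forall>x\<in>A. P x = Q x))"
  proof (cases "{x \<in> A. P x \<noteq> 0} \<subseteq> {x \<in> A. Q x \<noteq> 0}")
    case False
    then show ?thesis by (auto simp: rel_entropy_def)
  next
    case True
    then have re: "rel_entropy A P Q = ereal (\<Sum>x\<in>A. P x * ln (P x / Q x))"
      by (simp add: rel_entropy_def)
    have eq: "(\<Sum>x\<in>A. P x * ln (P x / Q x)) = (\<Sum>x\<in>A. P x * ln (P x / Q x) - (P x - Q x))"
      by (simp add: sum_subtractf mass)
    have nonneg: "0 \<le> P x * ln (P x / Q x) - (P x - Q x)" if "x \<in> A" for x
      using Gibbs_pointwise(1)[of "P x" "Q x"] assms that True by auto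
    have "(\<Sum>x\<in>A. P x * ln (P x / Q x)) = 0 \<longleftrightarrow> (\<forall>x\<in>A. P x * ln (P x / Q x) - (P x - Q x) = 0)"
      unfolding eq using nonneg assms(1) by (simp add: sum_nonneg_eq_0_iff)
    also have "\<dots> \<longleftrightarrow> (\<forall>x\<in>A. P x = Q x)"
      using Gibbs_pointwise(2) assms(2,3) True
      by (intro ball_cong refl) (simp add: subset_iff)
    finally show ?thesis
      unfolding re using nonneg by (simp add: eq sum_nonneg)
  qed
  then show "0 \<le> rel_entropy A P Q" and "rel_entropy A P Q = 0 \<longleftrightarrow> (\<forall>x\<in>A. P x = Q x)"
    by auto
qed

text \<open>Only points charged by \<open>P\<close> enter the divergence, so \<open>w\<close> has to be a density of \<open>Q\<close> with
  respect to \<open>R\<close> on the support of \<open>P\<close>; elsewhere \<open>Q\<close> may vanish where \<open>R\<close> does not.\<close>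

lemma rel_entropy_reweight:
  fixes P Q R w :: "'a \<Rightarrow> real"
  assumes "\<And>x. x \<in> A \<Longrightarrow> P x \<noteq> 0 \<Longrightarrow> 0 < P x \<and> 0 < R x \<and> 0 < w x \<and> Q x = R x * w x"
  shows "rel_entropy A P R = rel_entropy A P Q + ereal (\<Sum>x\<in>A. P x * ln (w x))"
proof -
  have "P x * ln (P x / R x) = P x * ln (P x / Q x) + P x * ln (w x)" if "x \<in> A" for x
    using assms[OF that] by (cases "P x = 0") (auto simp: ln_div ln_mult algebra_simps)
  then have "(\<Sum>x\<in>A. P x * ln (P x / R x)) = (\<Sum>x\<in>A. P x * ln (P x / Q x)) + (\<Sum>x\<in>A. P x * ln (w x))"
    by (simp add: sum.distrib)
  moreover have "{x \<in> A. P x \<noteq> 0} \<subseteq> {x \<in> A. R x \<noteq> 0}" "{x \<in> A. P x \<noteq> 0} \<subseteq> {x \<in> A. Q x \<noteq> 0}"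
    using assms by fastforce+
  ultimately show ?thesis
    by (simp add: rel_entropy_def)
qed

section \<open>The generalized Schroedinger system\<close>

locale schroedinger_system =
  fixes M :: "nat \<Rightarrow> real^'v::finite^'v"
    and \<mu>\<^sub>0 \<nu>\<^sub>0 \<nu>\<^sub>N :: "'v \<Rightarrow> real"
    and \<phi> \<phi>' :: "nat \<Rightarrow> 'v \<Rightarrow> real"
    and N :: nat
  assumes M_nonneg: "\<And>t i j. t < N \<Longrightarrow> 0 \<le> M t $ i $ j"
    and \<mu>\<^sub>0_pos: "\<And>i. 0 < \<mu>\<^sub>0 i"
    and \<nu>\<^sub>0: "prob_vector \<nu>\<^sub>0" and \<nu>\<^sub>N: "prob_vector \<nu>\<^sub>N"
    and G_pos: "\<And>i j. 0 < mat_prod M N $ i $ j"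
    and \<phi>_nonneg: "\<And>t i. t \<le> N \<Longrightarrow> 0 \<le> \<phi> t i"
    and \<phi>'_nonneg: "\<And>t i. t \<le> N \<Longrightarrow> 0 \<le> \<phi>' t i"
    and \<phi>_backward: "\<And>t i. t < N \<Longrightarrow> \<phi> t i = (\<Sum>j\<in>UNIV. M t $ i $ j * \<phi> (Suc t) j)"
    and \<phi>'_forward: "\<And>t j. t < N \<Longrightarrow> \<phi>' (Suc t) j = (\<Sum>i\<in>UNIV. M t $ i $ j * \<phi>' t i)"
    and initial_coupling: "\<And>i. \<phi> 0 i * \<phi>' 0 i = \<nu>\<^sub>0 i"
    and final_coupling: "\<And>j. (\<phi> N j)\<^sup>2 * \<phi>' N j = \<nu>\<^sub>N j"
begin

abbreviation prior :: "'v list \<Rightarrow> real" where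
  "prior \<equiv> path_measure N \<mu>\<^sub>0 M"

abbreviation optimum :: "'v list \<Rightarrow> real" where
  "optimum \<equiv> path_measure N \<nu>\<^sub>0 (opt_transition M \<phi>)"

text \<open>Solving the two recursions reduces the positivity of \<open>\<phi> 0\<close> and \<open>\<phi>' N\<close> to that of the matrix
  product.\<close>

lemma \<phi>_initial_eq:
  assumes "k \<le> N"
  shows "\<phi> 0 i = (\<Sum>j\<in>UNIV. mat_prod M k $ i $ j * \<phi> k j)"
  using assms
proof (induction k)
  case 0
  then show ?case by (simp add: mat_def if_distrib[of "\<lambda>z. z * _"] cong: if_cong)
next
  case (Suc k)
  then have "\<phi> 0 i = (\<Sum>l\<in>UNIV. \<Sum>j\<in>UNIV. mat_prod M k $ i $ l * M k $ l $ j * \<phi> (Suc k) j)"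
    by (simp add: \<phi>_backward sum_distrib_left mult.assoc)
  also have "\<dots> = (\<Sum>j\<in>UNIV. mat_prod M (Suc k) $ i $ j * \<phi> (Suc k) j)"
    by (subst sum.swap) (simp add: matrix_matrix_mult_def sum_distrib_right)
  finally show ?case .
qed

lemma \<phi>'_eq:
  assumes "k \<le> N"
  shows "\<phi>' k j = (\<Sum>i\<in>UNIV. \<phi>' 0 i * mat_prod M k $ i $ j)"
  using assms
proof (induction k arbitrary: j)
  case 0
  then show ?case by (simp add: mat_def if_distrib[of "\<lambda>z. _ * z"] cong: if_cong)
next
  case (Suc k)
  then have "\<phi>' (Suc k) j = (\<Sum>l\<in>UNIV. \<Sum>i\<in>UNIV. \<phi>' 0 i * mat_prod M k $ i $ l * M k $ l $ j)"
    by (simp add: \<phi>'_forward sum_distrib_left mult_ac)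
  also have "\<dots> = (\<Sum>i\<in>UNIV. \<phi>' 0 i * mat_prod M (Suc k) $ i $ j)"
    by (subst sum.swap) (simp add: matrix_matrix_mult_def sum_distrib_left mult_ac)
  finally show ?case .
qed

lemma \<phi>_initial_pos: "0 < \<phi> 0 i"
proof -
  have "\<exists>j. \<nu>\<^sub>N j \<noteq> 0"
  proof (rule ccontr)
    assume "\<not> (\<exists>j. \<nu>\<^sub>N j \<noteq> 0)"
    then show False using \<nu>\<^sub>N by (simp add: prob_vector_def)
  qed
  then obtain j where "\<phi> N j \<noteq> 0" using final_coupling by fastforce
  then have "0 < \<phi> N j" using \<phi>_nonneg[of N j] by simp
  then have "0 < (\<Sum>j\<in>UNIV. mat_prod M N $ i $ j * \<phi> N j)"
    by (intro sum_pos2[of _ j]) (auto intro!: mult_nonneg_nonneg \<phi>_nonneg less_imp_le[OF G_pos] simp: G_pos)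
  then show ?thesis using \<phi>_initial_eq[of N i] by simp
qed

lemma \<phi>'_final_pos: "0 < \<phi>' N j"
proof -
  have "\<exists>i. \<nu>\<^sub>0 i \<noteq> 0"
  proof (rule ccontr)
    assume "\<not> (\<exists>i. \<nu>\<^sub>0 i \<noteq> 0)"
    then show False using \<nu>\<^sub>0 by (simp add: prob_vector_def)
  qed
  then obtain i where "\<phi>' 0 i \<noteq> 0" using initial_coupling by fastforce
  then have "0 < \<phi>' 0 i" using \<phi>'_nonneg[of 0 i] by simp
  then have "0 < (\<Sum>i\<in>UNIV. \<phi>' 0 i * mat_prod M N $ i $ j)"
    by (intro sum_pos2[of _ i]) (auto intro!: mult_nonneg_nonneg \<phi>'_nonneg less_imp_le[OF G_pos] simp: G_pos)
  then show ?thesis using \<phi>'_eq[of N j] by simp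
qed

lemma \<nu>\<^sub>N_eq_0_iff: "\<nu>\<^sub>N j = 0 \<longleftrightarrow> \<phi> N j = 0"
  using final_coupling[of j] \<phi>'_final_pos[of j] by auto

lemma opt_transition_nonneg:
  assumes "t < N"
  shows "0 \<le> opt_transition M \<phi> t $ i $ j"
  using assms by (simp add: opt_transition_def M_nonneg \<phi>_nonneg)

lemma prob_vector_opt_transition:
  assumes "t < N" and "0 < \<phi> t i"
  shows "prob_vector (\<lambda>j. opt_transition M \<phi> t $ i $ j)"
proof -
  have "(\<Sum>j\<in>UNIV. opt_transition M \<phi> t $ i $ j) = \<phi> t i / \<phi> t i"
    using assms(1) by (simp add: opt_transition_def \<phi>_backward flip: sum_divide_distrib)
  then show ?thesis
    using assms by (simp add: prob_vector_def opt_transition_nonneg)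
qed

text \<open>The Doob transform of \<open>M\<close> by \<open>\<phi>\<close> in a form without division: it leaves the row at \<open>i\<close> free
  where \<open>\<phi> t i = 0\<close>, and so covers both the transition matrices of the candidate and any
  stochastic completion of their zero rows.\<close>

definition h_transform :: "(nat \<Rightarrow> real^'v^'v) \<Rightarrow> bool" where
  "h_transform \<pi> \<longleftrightarrow> (\<forall>t<N. \<forall>i j. \<phi> t i * \<pi> t $ i $ j = M t $ i $ j * \<phi> (Suc t) j)"

lemma M_mult_\<phi>_eq_0:
  assumes "t < N" and "\<phi> t i = 0"
  shows "M t $ i $ j * \<phi> (Suc t) j = 0"
proof -
  have "(\<Sum>j\<in>UNIV. M t $ i $ j * \<phi> (Suc t) j) = 0"
    using assms \<phi>_backward[of t i] by simp
  then show ?thesis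
    using assms(1) by (subst (asm) sum_nonneg_eq_0_iff) (auto simp: M_nonneg \<phi>_nonneg simp del: mult_eq_0_iff)
qed

lemma h_transform_opt_transition: "h_transform (opt_transition M \<phi>)"
  using M_mult_\<phi>_eq_0 by (auto simp: h_transform_def opt_transition_def)

text \<open>The factors \<open>\<phi> t\<close> telescope along the path.  As the right-hand side does not mention
  \<open>\<pi>\<close>, all Doob transforms induce the same path measure.\<close>

lemma path_measure_h_transform:
  assumes "h_transform \<pi>"
  shows "path_measure N \<nu>\<^sub>0 \<pi> x = path_measure N (\<phi>' 0) M x * \<phi> N (x ! N)"
proof -
  have "\<phi> 0 (x ! 0) * (\<Prod>t<k. \<pi> t $ (x ! t) $ (x ! Suc t))
      = (\<Prod>t<k. M t $ (x ! t) $ (x ! Suc t)) * \<phi> k (x ! k)" if "k \<le> N" for k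
    using that
  proof (induction k)
    case 0
    then show ?case by simp
  next
    case (Suc k)
    then have "\<phi> 0 (x ! 0) * (\<Prod>t<Suc k. \<pi> t $ (x ! t) $ (x ! Suc t))
      = (\<Prod>t<k. M t $ (x ! t) $ (x ! Suc t)) * (\<phi> k (x ! k) * \<pi> k $ (x ! k) $ (x ! Suc k))"
      by (simp add: mult_ac)
    also have "\<phi> k (x ! k) * \<pi> k $ (x ! k) $ (x ! Suc k)
      = M k $ (x ! k) $ (x ! Suc k) * \<phi> (Suc k) (x ! Suc k)"
      using assms Suc.prems by (simp add: h_transform_def)
    finally show ?case
      by (simp add: mult.assoc)
  qed
  from this[of N] show ?thesis
    by (simp add: path_measure_def mult_ac flip: initial_coupling)
qed

lemmas optimum_eq = path_measure_h_transform[OF h_transform_opt_transition]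

lemma optimum_nonneg: "0 \<le> optimum x"
  using \<nu>\<^sub>0 by (auto simp: prob_vector_def intro!: path_measure_nonneg opt_transition_nonneg)

lemma optimum_in_markov_family: "optimum \<in> markov_family N \<nu>\<^sub>0"
proof -
  \<comment> \<open>On zero rows the chain stays put; any other stochastic row would do.\<close>
  define \<pi> where "\<pi> = (\<lambda>t. \<chi> i j. if \<phi> t i = 0 then of_bool (j = i) else opt_transition M \<phi> t $ i $ j)"
  have "prob_vector (\<lambda>j. \<pi> t $ i $ j)" if "t < N" for t i
  proof (cases "\<phi> t i = 0")
    case True
    then show ?thesis by (simp add: \<pi>_def prob_vector_def of_bool_def)
  next
    case False
    then show ?thesis
      using prob_vector_opt_transition[OF that, of i] \<phi>_nonneg[of t i] that by (simp add: \<pi>_def)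
  qed
  then have "transition_probs N \<pi>"
    by (simp add: transition_probs_def)
  moreover have "h_transform \<pi>"
    using h_transform_opt_transition M_mult_\<phi>_eq_0 by (auto simp: h_transform_def \<pi>_def)
  then have "path_measure N \<nu>\<^sub>0 \<pi> = optimum"
    by (intro ext) (simp only: path_measure_h_transform optimum_eq)
  ultimately show ?thesis
    unfolding markov_family_def by (intro CollectI exI[of _ \<pi>]) simp
qed

lemma marginal_optimum_final: "marginal N optimum N j = \<phi>' N j * \<phi> N j"
proof -
  have "marginal N optimum N j = marginal N (path_measure N (\<phi>' 0) M) N j * \<phi> N j"
    unfolding marginal_def sum_distrib_right by (intro sum.cong refl) (auto simp: optimum_eq)
  then show ?thesis
    using \<phi>'_forward by (simp add: marginal_path_measure_final)
qed

text \<open>A state is entered with a probability proportional to the value of \<open>\<phi>\<close> there, so zeros of \<open>\<phi>\<close>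
  are never visited.\<close>

lemma marginal_optimum_pos_imp_\<phi>_pos:
  assumes "t \<le> N" and "0 < marginal N optimum t i"
  shows "0 < \<phi> t i"
proof -
  have "marginal N optimum t i \<noteq> 0" using assms by simp
  then obtain x where x: "x \<in> paths N" "x ! t = i" "optimum x \<noteq> 0"
    by (auto simp: marginal_eq_0_iff optimum_nonneg)
  show ?thesis
  proof (cases t)
    case 0
    then show ?thesis by (simp add: \<phi>_initial_pos)
  next
    case (Suc s)
    then have "opt_transition M \<phi> s $ (x ! s) $ (x ! t) \<noteq> 0"
      using x assms by (auto simp: path_measure_def)
    then have "\<phi> t i \<noteq> 0" using Suc x by (auto simp: opt_transition_def)
    then show ?thesis using \<phi>_nonneg[of t i] assms by simp
  qed
qed

text \<open>Changing the reference measures from the prior and \<open>\<nu>\<^sub>N\<close> to the optimum and its final marginal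
  costs the expected logarithms of the densities.  The part coming from the end state cancels
  between the two divergences; the part coming from the start is determined by \<open>\<nu>\<^sub>0\<close>.\<close>

lemma cost_decomposition:
  assumes P_nonneg: "\<And>x. 0 \<le> P x" and P_initial: "\<And>i. marginal N P 0 i = \<nu>\<^sub>0 i"
  shows "cost N prior \<nu>\<^sub>N P = rel_entropy (paths N) P optimum
    + rel_entropy UNIV (marginal N P N) (marginal N optimum N)
    + ereal (\<Sum>i\<in>UNIV. \<nu>\<^sub>0 i * ln (\<phi>' 0 i / \<mu>\<^sub>0 i))"
proof -
  define p where "p = marginal N P N"
  have p_nonneg: "0 \<le> p j" for j
    unfolding p_def by (rule marginal_nonneg) (rule P_nonneg)
  have p_eq_0: "p j = 0 \<longleftrightarrow> (\<forall>x\<in>paths N. x ! N = j \<longrightarrow> P x = 0)" for j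
    unfolding p_def by (rule marginal_eq_0_iff) (rule P_nonneg)
  have start: "0 < \<phi>' 0 (x ! 0)" if "x \<in> paths N" "P x \<noteq> 0" for x
  proof -
    have "\<nu>\<^sub>0 (x ! 0) \<noteq> 0"
      using that marginal_eq_0_iff[of P N 0 "x ! 0"] P_nonneg by (auto simp: P_initial)
    then have "\<phi>' 0 (x ! 0) \<noteq> 0" using initial_coupling[of "x ! 0"] by auto
    then show ?thesis using \<phi>'_nonneg[of 0 "x ! 0"] by simp
  qed
  have opt_prior: "optimum x = prior x * (\<phi>' 0 (x ! 0) / \<mu>\<^sub>0 (x ! 0) * \<phi> N (x ! N))" for x
    unfolding optimum_eq using \<mu>\<^sub>0_pos[of "x ! 0"] by (simp add: path_measure_def)
  show ?thesis
  proof (cases "\<forall>x\<in>paths N. P x \<noteq> 0 \<longrightarrow> optimum x \<noteq> 0")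
    case False
    \<comment> \<open>Both sides are infinite: a path charged by \<open>P\<close> and by the prior but not by the optimum
      ends at a zero of \<open>\<nu>\<^sub>N\<close>.\<close>
    then obtain x where x: "x \<in> paths N" "P x \<noteq> 0" "optimum x = 0" by auto
    have "prior x = 0 \<or> \<phi> N (x ! N) = 0"
      using x start[of x] \<mu>\<^sub>0_pos[of "x ! 0"] by (simp add: opt_prior)
    moreover have "p (x ! N) \<noteq> 0" using x by (auto simp: p_eq_0)
    ultimately have "rel_entropy (paths N) P prior = \<infinity> \<or> rel_entropy UNIV p \<nu>\<^sub>N = \<infinity>"
      using x by (auto simp: rel_entropy_def \<nu>\<^sub>N_eq_0_iff)
    moreover have "rel_entropy (paths N) P optimum = \<infinity>"
      using x by (auto simp: rel_entropy_def)
    ultimately show ?thesis by (auto simp: cost_def p_def)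
  next
    case True
    have prior_nonneg: "0 \<le> prior x" for x
      by (intro path_measure_nonneg M_nonneg less_imp_le[OF \<mu>\<^sub>0_pos])
    have supp: "0 < prior x" "0 < \<phi> N (x ! N)" if "x \<in> paths N" "P x \<noteq> 0" for x
      using True that prior_nonneg[of x] \<phi>_nonneg[of N "x ! N"] by (auto simp: opt_prior less_le)
    have supp_N: "0 < \<phi> N j" if "p j \<noteq> 0" for j
      using that supp by (auto simp: p_eq_0)
    have paths_part: "rel_entropy (paths N) P prior = rel_entropy (paths N) P optimum
        + ereal (\<Sum>x\<in>paths N. P x * ln (\<phi>' 0 (x ! 0) / \<mu>\<^sub>0 (x ! 0) * \<phi> N (x ! N)))"
      by (rule rel_entropy_reweight)
        (use P_nonneg start supp \<mu>\<^sub>0_pos in \<open>auto simp: opt_prior less_le\<close>)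
    have final_part: "rel_entropy UNIV p \<nu>\<^sub>N = rel_entropy UNIV p (marginal N optimum N)
        + ereal (\<Sum>j\<in>UNIV. p j * ln (1 / \<phi> N j))"
    proof (rule rel_entropy_reweight)
      fix j assume "p j \<noteq> 0"
      with supp_N[of j] p_nonneg[of j] \<phi>'_final_pos[of j]
      show "0 < p j \<and> 0 < \<nu>\<^sub>N j \<and> 0 < 1 / \<phi> N j \<and> marginal N optimum N j = \<nu>\<^sub>N j * (1 / \<phi> N j)"
        by (simp add: marginal_optimum_final power2_eq_square flip: final_coupling)
    qed
    have "(\<Sum>x\<in>paths N. P x * ln (\<phi>' 0 (x ! 0) / \<mu>\<^sub>0 (x ! 0) * \<phi> N (x ! N)))
      = (\<Sum>x\<in>paths N. P x * ln (\<phi>' 0 (x ! 0) / \<mu>\<^sub>0 (x ! 0)) + P x * ln (\<phi> N (x ! N)))"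
    proof (rule sum.cong[OF refl])
      fix x :: "'v list" assume "x \<in> paths N"
      then show "P x * ln (\<phi>' 0 (x ! 0) / \<mu>\<^sub>0 (x ! 0) * \<phi> N (x ! N))
        = P x * ln (\<phi>' 0 (x ! 0) / \<mu>\<^sub>0 (x ! 0)) + P x * ln (\<phi> N (x ! N))"
        using start[of x] supp[of x] \<mu>\<^sub>0_pos[of "x ! 0"]
        by (cases "P x = 0") (simp_all add: ln_mult_pos distrib_left del: times_divide_eq_left)
    qed
    also have "\<dots> = (\<Sum>i\<in>UNIV. \<nu>\<^sub>0 i * ln (\<phi>' 0 i / \<mu>\<^sub>0 i)) + (\<Sum>j\<in>UNIV. p j * ln (\<phi> N j))"
      by (simp add: sum.distrib p_def P_initial
          sum_paths_marginal[where h = "\<lambda>i. ln (\<phi>' 0 i / \<mu>\<^sub>0 i)"]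
          sum_paths_marginal[where h = "\<lambda>j. ln (\<phi> N j)"])
    also have "(\<Sum>j\<in>UNIV. p j * ln (\<phi> N j)) = - (\<Sum>j\<in>UNIV. p j * ln (1 / \<phi> N j))"
      unfolding sum_negf[symmetric]
    proof (rule sum.cong[OF refl])
      fix j
      show "p j * ln (\<phi> N j) = - (p j * ln (1 / \<phi> N j))"
        using supp_N[of j] by (cases "p j = 0") (auto simp: ln_div)
    qed
    finally have endpoint_terms: "ereal (\<Sum>x\<in>paths N. P x * ln (\<phi>' 0 (x ! 0) / \<mu>\<^sub>0 (x ! 0) * \<phi> N (x ! N)))
        + ereal (\<Sum>j\<in>UNIV. p j * ln (1 / \<phi> N j)) = ereal (\<Sum>i\<in>UNIV. \<nu>\<^sub>0 i * ln (\<phi>' 0 i / \<mu>\<^sub>0 i))"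
      by simp
    have "cost N prior \<nu>\<^sub>N P = (rel_entropy (paths N) P optimum
        + rel_entropy UNIV p (marginal N optimum N))
      + (ereal (\<Sum>x\<in>paths N. P x * ln (\<phi>' 0 (x ! 0) / \<mu>\<^sub>0 (x ! 0) * \<phi> N (x ! N)))
        + ereal (\<Sum>j\<in>UNIV. p j * ln (1 / \<phi> N j)))"
      unfolding cost_def p_def[symmetric] paths_part final_part by (simp only: ac_simps)
    then show ?thesis
      unfolding endpoint_terms unfolding p_def .
  qed
qed

section \<open>Optimality of the Doob transform\<close>

text \<open>The only traits of a feasible measure that matter for comparing costs.\<close>

lemma markov_family_properties:
  assumes "P \<in> markov_family N \<nu>\<^sub>0"
  shows "0 \<le> P x" and "marginal N P 0 i = \<nu>\<^sub>0 i" and "x \<notin> paths N \<Longrightarrow> P x = 0"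
    and "(\<Sum>x\<in>paths N. P x) = 1"
proof -
  obtain \<pi> where P: "P = path_measure N \<nu>\<^sub>0 \<pi>" and \<pi>: "transition_probs N \<pi>"
    using assms by (auto simp: markov_family_def)
  show "0 \<le> P x"
    unfolding P using \<nu>\<^sub>0 \<pi>
    by (intro path_measure_nonneg) (auto simp: prob_vector_def transition_probs_def)
  show initial: "marginal N P 0 i = \<nu>\<^sub>0 i" for i
    unfolding P using \<pi>
    by (intro marginal_path_measure_initial) (auto simp: prob_vector_def transition_probs_def)
  show "P x = 0" if "x \<notin> paths N"
    using that by (simp add: P path_measure_def)
  show "(\<Sum>x\<in>paths N. P x) = 1"
    using \<nu>\<^sub>0 by (simp add: sum_paths_eq_sum_marginal[of P N 0] initial prob_vector_def)
qed

lemma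
  assumes P: "P \<in> markov_family N \<nu>\<^sub>0"
  shows cost_optimum_le: "cost N prior \<nu>\<^sub>N optimum \<le> cost N prior \<nu>\<^sub>N P"
    and cost_optimum_less: "P \<noteq> optimum \<Longrightarrow> cost N prior \<nu>\<^sub>N optimum < cost N prior \<nu>\<^sub>N P"
proof -
  define c where "c = (\<Sum>i\<in>UNIV. \<nu>\<^sub>0 i * ln (\<phi>' 0 i / \<mu>\<^sub>0 i))"
  define D where "D = (\<lambda>P. rel_entropy (paths N) P optimum)"
  define D\<^sub>N where "D\<^sub>N = (\<lambda>P. rel_entropy UNIV (marginal N P N) (marginal N optimum N))"
  note props = markov_family_properties
  note opt = optimum_in_markov_family
  have cost_eq: "cost N prior \<nu>\<^sub>N P = D P + D\<^sub>N P + ereal c" if "P \<in> markov_family N \<nu>\<^sub>0" for P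
    unfolding c_def D_def D\<^sub>N_def by (rule cost_decomposition) (auto simp: props[OF that])
  have D_nonneg: "0 \<le> D P" and D_eq_0_iff: "D P = 0 \<longleftrightarrow> (\<forall>x\<in>paths N. P x = optimum x)"
    if "P \<in> markov_family N \<nu>\<^sub>0" for P
    unfolding D_def
    by (rule rel_entropy_nonneg rel_entropy_eq_0_iff;
        simp add: finite_paths props[OF that] props[OF opt] optimum_nonneg)+
  have D\<^sub>N_nonneg: "0 \<le> D\<^sub>N P"
    unfolding D\<^sub>N_def
    by (rule rel_entropy_nonneg)
      (auto intro!: marginal_nonneg props[OF P] optimum_nonneg
        simp: props[OF P] props[OF opt] simp flip: sum_paths_eq_sum_marginal)
  have "D\<^sub>N optimum = 0"
    unfolding D\<^sub>N_def
    by (subst rel_entropy_eq_0_iff) (auto intro!: marginal_nonneg optimum_nonneg)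
  then have cost_opt: "cost N prior \<nu>\<^sub>N optimum = 0 + ereal c"
    using cost_eq[OF opt] D_eq_0_iff[OF opt] by simp
  show "cost N prior \<nu>\<^sub>N optimum \<le> cost N prior \<nu>\<^sub>N P"
    unfolding cost_opt cost_eq[OF P] using D_nonneg[OF P] D\<^sub>N_nonneg
    by (intro add_right_mono) simp
  show "cost N prior \<nu>\<^sub>N optimum < cost N prior \<nu>\<^sub>N P" if neq: "P \<noteq> optimum"
  proof -
    obtain x where x: "P x \<noteq> optimum x" using neq by (auto simp: fun_eq_iff)
    then have "x \<in> paths N" using props(3)[OF P, of x] props(3)[OF opt, of x] by metis
    then have "0 < D P" using x D_nonneg[OF P] D_eq_0_iff[OF P] by (auto simp: less_le)
    then have "0 < D P + D\<^sub>N P" using D\<^sub>N_nonneg by (rule add_pos_nonneg)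
    then show ?thesis
      unfolding cost_opt cost_eq[OF P] by (cases "D P + D\<^sub>N P") auto
  qed
qed

theorem is_arg_min_cost_iff:
  "is_arg_min (cost N prior \<nu>\<^sub>N) (\<lambda>P. P \<in> markov_family N \<nu>\<^sub>0) P \<longleftrightarrow> P = optimum"
  using cost_optimum_le cost_optimum_less optimum_in_markov_family
  unfolding is_arg_min_def by (metis leD)

end

theorem theorem1:
  fixes E :: "('v::finite \<times> 'v) set"
    and M :: "nat \<Rightarrow> real^'v^'v"
    and \<mu>\<^sub>0 \<nu>\<^sub>0 \<nu>\<^sub>N :: "'v \<Rightarrow> real"
    and \<phi> \<phi>' :: "nat \<Rightarrow> 'v \<Rightarrow> real"
    and N :: nat
  assumes "strongly_connected E" and "aperiodic E"
    and "1 \<le> N"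
    and "\<And>t i j. t < N \<Longrightarrow> 0 \<le> M t $ i $ j"
    and "\<And>t i j. t < N \<Longrightarrow> (i, j) \<notin> E \<Longrightarrow> M t $ i $ j = 0"
    and "\<And>i. 0 < \<mu>\<^sub>0 i"
    and "prob_vector \<nu>\<^sub>0" and "prob_vector \<nu>\<^sub>N"
    and "\<And>i j. 0 < mat_prod M N $ i $ j"
    and "\<And>t i. t \<le> N \<Longrightarrow> 0 \<le> \<phi> t i"
    and "\<And>t i. t \<le> N \<Longrightarrow> 0 \<le> \<phi>' t i"
    and "\<And>t i. t < N \<Longrightarrow> \<phi> t i = (\<Sum>j\<in>UNIV. M t $ i $ j * \<phi> (Suc t) j)"
    and "\<And>t j. t < N \<Longrightarrow> \<phi>' (Suc t) j = (\<Sum>i\<in>UNIV. M t $ i $ j * \<phi>' t i)"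
    and "\<And>i. \<phi> 0 i * \<phi>' 0 i = \<nu>\<^sub>0 i"
    and "\<And>j. (\<phi> N j)\<^sup>2 * \<phi>' N j = \<nu>\<^sub>N j"
  shows "(\<forall>i. 0 < \<phi> 0 i) \<and>
    (\<forall>t<N. \<forall>i. 0 < \<phi> t i \<longrightarrow> prob_vector (\<lambda>j. opt_transition M \<phi> t $ i $ j)) \<and>
    (\<forall>t<N. \<forall>i. 0 < marginal N (path_measure N \<nu>\<^sub>0 (opt_transition M \<phi>)) t i \<longrightarrow> 0 < \<phi> t i) \<and>
    (\<forall>P. is_arg_min (cost N (path_measure N \<mu>\<^sub>0 M) \<nu>\<^sub>N) (\<lambda>P. P \<in> markov_family N \<nu>\<^sub>0) P
      \<longleftrightarrow> P = path_measure N \<nu>\<^sub>0 (opt_transition M \<phi>))"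
proof -
  interpret schroedinger_system M \<mu>\<^sub>0 \<nu>\<^sub>0 \<nu>\<^sub>N \<phi> \<phi>' N
    by unfold_locales (fact assms)+
  show ?thesis
    using \<phi>_initial_pos prob_vector_opt_transition marginal_optimum_pos_imp_\<phi>_pos
      is_arg_min_cost_iff
    by (simp add: less_imp_le)
qed

end
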